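(* Let $P$ be a Markov kernel on a finite state space $S$ with $|S|=n\ge2$, reversible with respect to a stationary distribution $\pi$ of full support. Then $$I(X_0;X_1)=\sum_{x\in S}\pi(x)\,D_{\mathrm{KL}}(P(x,\cdot)\|\pi)\le\sum_{i=2}^n\lambda_i^2.$$ Consequently, $$\bar r_\pi\le\frac{\sum_{i=2}^n\lambda_i^2}{\log(1/\pi_{\max})},\qquad \pi_{\max}=\max_{x\in S}\pi(x).$$ If $\pi$ is uniform, then $$\bar r_\pi\le\frac{\sum_{i=2}^n\lambda_i^2}{\log n}\le\frac{(n-1)(1-\gamma)^2}{\log n}.$$
   Context: All logarithms are natural, with $0\log0=0$. $D_{\mathrm{KL}}(\mu\|\nu)=\sum_{x}\mu(x)\log\frac{\mu(x)}{\nu(x)}$. Reversible means $\pi(x)P(x,y)=\pi(y)P(y,x)$ for all $x,y$. $1=\lambda_1\ge\lambda_2\ge\cdots\ge\lambda_n\ge-1$ are the eigenvalues of $P$ in $L^2(\pi)$ (with multiplicity), and $\gamma=\gamma(P):=1-\max_{i\ge2}|\lambda_i|$ is the absolute spectral gap. $(X_0,X_1)$ is the stationary one-step pair: $X_0\sim\pi$, $X_1\mid X_0=x\sim P(x,\cdot)$, with mutual information $I(X_0;X_1):=\sum_{x,y}\pi(x)P(x,y)\log\frac{P(x,y)}{\pi(y)}$. The local KL retention ratio is $r(x):=D_{\mathrm{KL}}(P(x,\cdot)\|\pi)/\log(1/\pi(x))$ and $\bar r_\pi:=\sum_x\pi(x)r(x)$. *)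

theory Defs
  imports "HOL-Analysis.Analysis" "HOL-Probability.Probability"
begin

text \<open>
  The state space is a finite type, a Markov kernel assigns to each state \<open>x\<close> the
  distribution \<open>P x\<close>, so that \<open>pmf (P x) y\<close> is the entry \<open>P(x, y)\<close>.
\<close>

definition stationary :: "('s::finite \<Rightarrow> 's pmf) \<Rightarrow> 's pmf \<Rightarrow> bool" where
  "stationary P \<pi> \<longleftrightarrow> bind_pmf \<pi> P = \<pi>"

definition reversible :: "('s::finite \<Rightarrow> 's pmf) \<Rightarrow> 's pmf \<Rightarrow> bool" where
  "reversible P \<pi> \<longleftrightarrow> (\<forall>x y. pmf \<pi> x * pmf (P x) y = pmf \<pi> y * pmf (P y) x)"

text \<open>
  The convention \<open>0 log 0 = 0\<close> is automatic because of the factor \<open>pmf \<mu> x\<close>.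
  Where \<open>\<nu>\<close> vanishes but \<open>\<mu>\<close> does not, the value \<open>\<infinity>\<close> is not represented
  (\<open>ln (a / 0) = 0\<close>); the definition is meant for \<open>\<nu>\<close> of full support.
\<close>

definition kl_div :: "'s::finite pmf \<Rightarrow> 's pmf \<Rightarrow> real" where
  "kl_div \<mu> \<nu> = (\<Sum>x\<in>UNIV. pmf \<mu> x * ln (pmf \<mu> x / pmf \<nu> x))"

text \<open>Mutual information of the stationary pair \<open>X\<^sub>0 \<sim> \<pi>\<close>, \<open>X\<^sub>1 | X\<^sub>0 = x \<sim> P x\<close>.\<close>

definition one_step_info :: "('s::finite \<Rightarrow> 's pmf) \<Rightarrow> 's pmf \<Rightarrow> real" where
  "one_step_info P \<pi> =
     (\<Sum>x\<in>UNIV. \<Sum>y\<in>UNIV. pmf \<pi> x * pmf (P x) y * ln (pmf (P x) y / pmf \<pi> y))"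

definition kl_retention :: "('s::finite \<Rightarrow> 's pmf) \<Rightarrow> 's pmf \<Rightarrow> 's \<Rightarrow> real" where
  "kl_retention P \<pi> x = kl_div (P x) \<pi> / ln (1 / pmf \<pi> x)"

definition mean_kl_retention :: "('s::finite \<Rightarrow> 's pmf) \<Rightarrow> 's pmf \<Rightarrow> real" where
  "mean_kl_retention P \<pi> = (\<Sum>x\<in>UNIV. pmf \<pi> x * kl_retention P \<pi> x)"

text \<open>
  For \<open>\<pi>\<close> of full support, \<open>L\<^sup>2(\<pi>)\<close> consists of all functions on the state space,
  represented as vectors of type \<open>real ^ 's\<close>. The kernel acts by
  \<open>(P f)(x) = (\<Sum>y. P(x, y) f(y))\<close>, which is \<open>transition_matrix P *v f\<close>.
\<close>

definition transition_matrix :: "('s::finite \<Rightarrow> 's pmf) \<Rightarrow> real ^ 's ^ 's" where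
  "transition_matrix P = (\<chi> x y. pmf (P x) y)"

definition eigenspace :: "real ^ 'n ^ 'n \<Rightarrow> real \<Rightarrow> (real ^ 'n) set" where
  "eigenspace A t = {v. A *v v = t *\<^sub>R v}"

definition spectrum_set :: "real ^ 'n ^ 'n \<Rightarrow> real set" where
  "spectrum_set A = {t. eigenspace A t \<noteq> {0}}"

lemma finite_spectrum_set:
  fixes A :: "real ^ 'n ^ 'n"
  shows "finite (spectrum_set A)"
proof -
  define v where "v t = (SOME x. x \<in> eigenspace A t \<and> x \<noteq> 0)" for t
  have v: "A *v v t = t *\<^sub>R v t" "v t \<noteq> 0" if "t \<in> spectrum_set A" for t
  proof -
    have "0 \<in> eigenspace A t" by (simp add: eigenspace_def)
    with that have "\<exists>x. x \<in> eigenspace A t \<and> x \<noteq> 0"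
      unfolding spectrum_set_def by auto
    from someI_ex[OF this] show "A *v v t = t *\<^sub>R v t" "v t \<noteq> 0"
      unfolding v_def eigenspace_def by auto
  qed
  have inj: "inj_on v (spectrum_set A)"
  proof (rule inj_onI)
    fix s t assume "s \<in> spectrum_set A" "t \<in> spectrum_set A" "v s = v t"
    with v[of s] v[of t] show "s = t" by (metis scaleR_right_imp_eq)
  qed
  have scal: "\<forall>t\<in>T. c t = 0"
    if "finite T" "T \<subseteq> spectrum_set A" "(\<Sum>t\<in>T. c t *\<^sub>R v t) = 0" for T c
    using that
  proof (induction T arbitrary: c rule: finite_induct)
    case (insert s T)
    have sum0: "c s *\<^sub>R v s + (\<Sum>t\<in>T. c t *\<^sub>R v t) = 0"
      using insert by simp
    have "A *v (c s *\<^sub>R v s + (\<Sum>t\<in>T. c t *\<^sub>R v t))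
        = c s *\<^sub>R (A *v v s) + (\<Sum>t\<in>T. c t *\<^sub>R (A *v v t))"
      by (simp add: matrix_vector_right_distrib linear_sum[OF matrix_vector_mul_linear]
          matrix_vector_mult_scaleR)
    also have "\<dots> = (c s * s) *\<^sub>R v s + (\<Sum>t\<in>T. (c t * t) *\<^sub>R v t)"
      using insert.prems v by (auto intro!: sum.cong)
    finally have "(c s * s) *\<^sub>R v s + (\<Sum>t\<in>T. (c t * t) *\<^sub>R v t) = 0"
      using sum0 by simp
    moreover have "s *\<^sub>R (c s *\<^sub>R v s + (\<Sum>t\<in>T. c t *\<^sub>R v t)) = 0"
      using sum0 by simp
    ultimately have "(\<Sum>t\<in>T. (c t * t) *\<^sub>R v t) - s *\<^sub>R (\<Sum>t\<in>T. c t *\<^sub>R v t) = 0"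
      by (simp add: scaleR_add_right mult.commute) (metis add_left_cancel)
    then have "(\<Sum>t\<in>T. (c t * (t - s)) *\<^sub>R v t) = 0"
      by (simp add: scaleR_sum_right sum_subtractf[symmetric] algebra_simps)
    then have "\<forall>t\<in>T. c t * (t - s) = 0"
      using insert.IH[of "\<lambda>t. c t * (t - s)"] insert.prems by simp
    then have T0: "\<forall>t\<in>T. c t = 0" using insert.hyps by auto
    then have "c s *\<^sub>R v s = 0" using sum0 by simp
    then show ?case using T0 v(2)[of s] insert.prems by auto
  qed simp
  have "card T \<le> CARD('n)" if "finite T" "T \<subseteq> spectrum_set A" for T
  proof -
    have injT: "inj_on v T" using inj that inj_on_subset by blast
    have "independent (v ` T)"
    proof (rule independent_if_scalars_zero)
      fix f x assume "(\<Sum>y\<in>v ` T. f y *\<^sub>R y) = 0" "x \<in> v ` T"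
      then show "f x = 0"
        using scal[OF that, of "\<lambda>t. f (v t)"] injT by (auto simp: sum.reindex)
    qed (use that in simp)
    then show ?thesis
      using independent_bound[of "v ` T"] injT by (simp add: card_image)
  qed
  then show ?thesis
    by (metis finite_if_finite_subsets_card_bdd)
qed

text \<open>
  Eigenvalues in weakly decreasing order, each repeated according to the dimension of its
  eigenspace; for a kernel reversible with respect to \<open>\<pi>\<close> of full support, hence
  self-adjoint on \<open>L\<^sup>2(\<pi>)\<close>, these are all \<open>n\<close> eigenvalues. The \<open>i\<close>-th one is indexed
  from \<open>1\<close>, as in \<open>\<lambda>\<^sub>1 \<ge> \<dots> \<ge> \<lambda>\<^sub>n\<close>.
\<close>

definition eigenvalue_mset :: "real ^ 'n ^ 'n \<Rightarrow> real multiset" where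
  "eigenvalue_mset A = (\<Sum>t\<in>spectrum_set A. replicate_mset (dim (eigenspace A t)) t)"

definition eigval :: "('s::finite \<Rightarrow> 's pmf) \<Rightarrow> nat \<Rightarrow> real" where
  "eigval P i = rev (sorted_list_of_multiset (eigenvalue_mset (transition_matrix P))) ! (i - 1)"

definition abs_spectral_gap :: "('s::finite \<Rightarrow> 's pmf) \<Rightarrow> real" where
  "abs_spectral_gap P = 1 - Max ((\<lambda>i. \<bar>eigval P i\<bar>) ` {2..CARD('s)})"

end

theory Submission
  imports Defs
begin

text \<open>
  Kullback--Leibler divergence is at most \<open>\<chi>\<^sup>2\<close>-divergence, because \<open>ln u \<le> u - 1\<close>. By
  reversibility \<open>P(x,y) / \<pi>(y) = P(y,x) / \<pi>(x)\<close>, so the \<open>\<pi>\<close>-average of the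
  \<open>\<chi>\<^sup>2\<close>-divergences of the rows is \<open>tr(P\<^sup>2) - 1\<close>. With \<open>D = diag(sqrt \<circ> \<pi>)\<close>, the matrix
  \<open>D P D\<^sup>-\<^sup>1\<close> is symmetric and its eigenspaces are the images under \<open>D\<close> of those of \<open>P\<close>;
  hence \<open>tr(P\<^sup>2)\<close> is the sum of the squared eigenvalues, the largest of which is \<open>1\<close>.
\<close>

section \<open>Orthonormal eigenbases of self-adjoint maps\<close>

text \<open>The eigenvector maximises the Rayleigh quotient on \<open>V\<close>.\<close>

lemma selfadjoint_has_eigenvector:
  fixes f :: "'a::euclidean_space \<Rightarrow> 'a"
  assumes lin: "linear f" and sa: "\<And>x y. f x \<bullet> y = x \<bullet> f y"
    and V: "subspace V" "V \<noteq> {0}" "f ` V \<subseteq> V"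
  obtains x t where "x \<in> V" "norm x = 1" "f x = t *\<^sub>R x"
proof -
  let ?K = "sphere 0 1 \<inter> V"
  obtain v where v: "v \<in> V" "v \<noteq> 0"
    using V subspace_0 by blast
  then have "v /\<^sub>R norm v \<in> ?K"
    using V(1) by (auto simp: subspace_scale)
  then have ne: "?K \<noteq> {}" by blast
  have "compact ?K"
    using closed_subspace[OF V(1)] by (intro compact_Int_closed) auto
  moreover have "continuous_on ?K (\<lambda>x. f x \<bullet> x)"
    using linear_continuous_on[OF lin[unfolded linear_conv_bounded_linear]]
    by (intro continuous_intros)
  ultimately obtain x where x: "x \<in> ?K" and max: "\<And>y. y \<in> ?K \<Longrightarrow> f y \<bullet> y \<le> f x \<bullet> x"
    using continuous_attains_sup[of ?K "\<lambda>x. f x \<bullet> x"] ne by blast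
  define m where "m = f x \<bullet> x"
  have xx: "x \<bullet> x = 1" and xV: "x \<in> V" using x by (auto simp: norm_eq_1)
  \<comment> \<open>The form is homogeneous of degree two, so the maximum over unit vectors bounds
    it on all of \<open>V\<close>; only \<open>y = 0\<close> cannot be normalised.\<close>
  have le: "f y \<bullet> y \<le> m * (y \<bullet> y)" if "y \<in> V" for y
  proof (cases "y = 0")
    case False
    have "y /\<^sub>R norm y \<in> ?K" using that False V(1) by (auto simp: subspace_scale)
    from max[OF this] have "(f y \<bullet> y) / (norm y * norm y) \<le> m"
      by (simp add: linear_scale[OF lin] m_def divide_simps)
    with False show ?thesis
      by (simp add: divide_simps dot_square_norm power2_eq_square)
  qed (simp add: linear_0[OF lin])
  define w where "w = m *\<^sub>R x - f x"
  have wV: "w \<in> V" unfolding w_def using V xV by (auto intro!: subspace_diff subspace_scale)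
  \<comment> \<open>The form \<open>m (y \<bullet> y) - f y \<bullet> y\<close> is nonnegative on \<open>V\<close> and vanishes at \<open>x\<close>,
     so its derivative at \<open>x\<close> in direction \<open>w\<close>, which is \<open>2 (w \<bullet> w)\<close>, is zero.\<close>
  have key: "0 \<le> 2 * e * (w \<bullet> w) + e\<^sup>2 * (m * (w \<bullet> w) - f w \<bullet> w)" for e :: real
  proof -
    have "f (x + e *\<^sub>R w) \<bullet> (x + e *\<^sub>R w) \<le> m * ((x + e *\<^sub>R w) \<bullet> (x + e *\<^sub>R w))"
      using V(1) xV wV by (intro le) (auto intro!: subspace_add subspace_scale)
    then have "0 \<le> 2 * e * (m * (x \<bullet> w) - f x \<bullet> w) + e\<^sup>2 * (m * (w \<bullet> w) - f w \<bullet> w)"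
      using xx m_def sa[of w x]
      by (simp add: linear_add[OF lin] linear_scale[OF lin] inner_add_left inner_add_right
          inner_commute power2_eq_square algebra_simps)
    moreover have "m * (x \<bullet> w) - f x \<bullet> w = w \<bullet> w"
      by (metis inner_diff_left inner_scaleR_left w_def)
    ultimately show ?thesis by simp
  qed
  have "w \<bullet> w = 0"
  proof (rule ccontr)
    assume "w \<bullet> w \<noteq> 0"
    then have p: "w \<bullet> w > 0" by simp
    define c where "c = m * (w \<bullet> w) - f w \<bullet> w"
    \<comment> \<open>Chosen small enough that \<open>e * \<bar>c\<bar> < w \<bullet> w\<close>: at
      \<open>- e\<close> the negative linear term of \<open>key\<close> then outweighs the quadratic
      one.\<close>
    define e where "e = (w \<bullet> w) / (\<bar>c\<bar> + 1)"
    have e: "e > 0" "e * (\<bar>c\<bar> + 1) = w \<bullet> w" using p by (auto simp: e_def)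
    have "e * c \<le> e * (\<bar>c\<bar> + 1)" using e(1) by (intro mult_left_mono) auto
    then have "e * c < 2 * (w \<bullet> w)" using e(2) p by linarith
    then have "e * (e * c) < e * (2 * (w \<bullet> w))" using e(1) by (rule mult_strict_left_mono)
    then show False using key[of "- e"] by (simp add: c_def power2_eq_square algebra_simps)
  qed
  then have "f x = m *\<^sub>R x" by (simp add: w_def)
  with that xV xx show thesis by (simp add: norm_eq_1)
qed

text \<open>Induction on the dimension of \<open>V\<close>: split off a unit eigenvector
  \<open>x\<close> and continue in its orthogonal complement within \<open>V\<close>, which
  self-adjointness makes invariant under \<open>f\<close>.\<close>

lemma selfadjoint_orthonormal_eigenbasis:
  fixes f :: "'a::euclidean_space \<Rightarrow> 'a"
  assumes lin: "linear f" and sa: "\<And>x y. f x \<bullet> y = x \<bullet> f y"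
    and "subspace V" "f ` V \<subseteq> V"
  shows "\<exists>B\<subseteq>V. pairwise orthogonal B \<and> (\<forall>b\<in>B. norm b = 1 \<and> (\<exists>t. f b = t *\<^sub>R b)) \<and> span B = V"
  using assms(3,4)
proof (induction "dim V" arbitrary: V rule: less_induct)
  case less
  show ?case
  proof (cases "V = {0}")
    case True
    then show ?thesis by (intro exI[of _ "{}"]) auto
  next
    case False
    obtain x t where x: "x \<in> V" "norm x = 1" "f x = t *\<^sub>R x"
      using selfadjoint_has_eigenvector[OF lin sa less.prems(1) False less.prems(2)] by blast
    let ?W = "{v \<in> V. v \<bullet> x = 0}"
    have W: "subspace ?W"
      using less.prems(1) by (auto simp: subspace_def inner_add_left)
    have inv: "f ` ?W \<subseteq> ?W"
      using less.prems(2) x by (auto simp: sa)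
    have "x \<notin> ?W" using x(2) by (auto simp: norm_eq_1)
    then have "?W \<subset> V" using x(1) by blast
    \<comment> \<open>\<open>dim_psubset\<close> compares spans, and both subspaces are their own
      spans.\<close>
    then have "span ?W \<subset> span V"
      using W less.prems(1) by (simp only: span_eq_iff[THEN iffD2])
    then have "dim ?W < dim V" by (rule dim_psubset)
    from less.hyps[OF this W inv] obtain B where
      B: "B \<subseteq> ?W" "pairwise orthogonal B"
        "\<forall>b\<in>B. norm b = 1 \<and> (\<exists>t. f b = t *\<^sub>R b)" "span B = ?W"
      by blast
    have "v \<in> span (insert x B)" if "v \<in> V" for v
    proof -
      have "v - (v \<bullet> x) *\<^sub>R x \<in> ?W"
        using that x less.prems(1)
        by (auto intro!: subspace_diff subspace_scale simp: inner_diff_left norm_eq_1)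
      then show ?thesis
        unfolding span_insert B(4) by blast
    qed
    moreover have "span (insert x B) \<subseteq> V"
      using x B less.prems(1) by (intro span_minimal) auto
    moreover have "pairwise orthogonal (insert x B)"
      using B(1,2) by (auto simp: pairwise_insert orthogonal_def inner_commute)
    ultimately show ?thesis
      using x B by (intro exI[of _ "insert x B"]) auto
  qed
qed

section \<open>Eigenvalues of symmetrizable matrices\<close>

lemma subspace_eigenspace: "subspace (eigenspace A t)"
  by (auto simp: eigenspace_def subspace_def matrix_vector_right_distrib
      matrix_vector_mult_scaleR scaleR_add_right)

text \<open>Outside the spectrum the eigenspace is \<open>{0}\<close>, of dimension 0, so every real
  \<open>t\<close> is covered and eigenvalue multisets can be compared through dimensions
  alone.\<close>

lemma count_eigenvalue_mset: "count (eigenvalue_mset A) t = dim (eigenspace A t)"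
proof -
  have "count (eigenvalue_mset A) t =
      (\<Sum>s\<in>spectrum_set A. if s = t then dim (eigenspace A s) else 0)"
    unfolding eigenvalue_mset_def by (auto simp: count_sum intro!: sum.cong)
  also have "\<dots> = (if t \<in> spectrum_set A then dim (eigenspace A t) else 0)"
    by (simp add: finite_spectrum_set)
  finally show ?thesis by (auto simp: spectrum_set_def)
qed

text \<open>An orthonormal eigenbasis \<open>B\<close> lists the eigenvalues with multiplicity,
  because each eigenspace is spanned by the members of \<open>B\<close> in it. By symmetry the trace
  is the sum of the squared entries of \<open>S\<close>, which Parseval over \<open>B\<close> turns
  into squared eigenvalues.\<close>

lemma eigenvalue_mset_symmetric:
  fixes S :: "real ^ 'n ^ 'n"
  assumes sym: "transpose S = S"
  shows "size (eigenvalue_mset S) = CARD('n)"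
    and "(\<Sum>t\<in>#eigenvalue_mset S. t\<^sup>2) = trace (S ** S)"
proof -
  have lin: "linear ((*v) S)" by simp
  have sa: "(S *v x) \<bullet> y = x \<bullet> (S *v y)" for x y
    by (metis dot_lmul_matrix sym transpose_matrix_vector)
  obtain B where orth: "pairwise orthogonal B" and n1: "\<And>b. b \<in> B \<Longrightarrow> norm b = 1"
    and ex: "\<forall>b\<in>B. \<exists>t. S *v b = t *\<^sub>R b" and sp: "span B = UNIV"
    using selfadjoint_orthonormal_eigenbasis[OF lin sa, of UNIV] by auto
  obtain ev where ev: "\<And>b. b \<in> B \<Longrightarrow> S *v b = ev b *\<^sub>R b"
    using ex by metis
  have ind: "independent B"
    using orth n1 by (intro pairwise_orthogonal_independent) force+
  then have fin: "finite B" by (rule independent_imp_finite)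
  have expand: "(\<Sum>b\<in>B. (v \<bullet> b) *\<^sub>R b) = v" for v
    using orthonormal_basis_expand[OF orth n1 _ fin] sp by simp
  have parseval: "v \<bullet> w = (\<Sum>b\<in>B. (v \<bullet> b) * (w \<bullet> b))" for v w
  proof -
    have "v \<bullet> w = (\<Sum>b\<in>B. (v \<bullet> b) *\<^sub>R b) \<bullet> w" by (simp only: expand)
    also have "\<dots> = (\<Sum>b\<in>B. (v \<bullet> b) * (w \<bullet> b))"
      by (simp add: inner_sum_left inner_commute[of w])
    finally show ?thesis .
  qed
  have eig: "eigenspace S t = span {b \<in> B. ev b = t}" for t
  proof
    show "span {b \<in> B. ev b = t} \<subseteq> eigenspace S t"
      using ev by (intro span_minimal subspace_eigenspace) (auto simp: eigenspace_def)
    show "eigenspace S t \<subseteq> span {b \<in> B. ev b = t}"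
    proof
      fix v assume "v \<in> eigenspace S t"
      then have v: "S *v v = t *\<^sub>R v" by (simp add: eigenspace_def)
      have "(v \<bullet> b) *\<^sub>R b \<in> span {b \<in> B. ev b = t}" if b: "b \<in> B" for b
      proof (cases "ev b = t")
        case True
        then show ?thesis using b by (intro span_scale span_base) auto
      next
        case False
        \<comment> \<open>Eigenvectors of a symmetric matrix for different eigenvalues are
          orthogonal, so this coefficient vanishes.\<close>
        have "t * (v \<bullet> b) = ev b * (v \<bullet> b)" using sa[of v b] v ev[OF b] by simp
        with False show ?thesis by (simp add: span_zero)
      qed
      then have "(\<Sum>b\<in>B. (v \<bullet> b) *\<^sub>R b) \<in> span {b \<in> B. ev b = t}" by (intro span_sum)
      then show "v \<in> span {b \<in> B. ev b = t}" by (simp only: expand)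
    qed
  qed
  have mset: "eigenvalue_mset S = image_mset ev (mset_set B)"
  proof (rule multiset_eqI)
    fix t
    have "independent {b \<in> B. ev b = t}" using ind by (rule independent_mono) auto
    then have "dim (eigenspace S t) = card {b \<in> B. ev b = t}"
      unfolding eig dim_span by (rule dim_eq_card_independent)
    also have "\<dots> = count (image_mset ev (mset_set B)) t"
      using fin by (simp add: count_image_mset_eq_card_vimage conj_commute eq_commute)
    finally show "count (eigenvalue_mset S) t = count (image_mset ev (mset_set B)) t"
      by (simp add: count_eigenvalue_mset)
  qed
  show "size (eigenvalue_mset S) = CARD('n)"
    using ind sp dim_eq_card_independent[OF ind] dim_span[of B] by (simp add: mset)
  have "trace (S ** S) = (\<Sum>i\<in>UNIV. row i S \<bullet> row i S)"
  proof -
    have "S $ i $ j = S $ j $ i" for i j by (metis sym transpose_def vec_lambda_beta)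
    then show ?thesis
      by (simp add: trace_def matrix_matrix_mult_def inner_vec_def row_def)
  qed
  \<comment> \<open>Parseval is applied to each row; \<open>row i S \<bullet> b\<close> is entry
    \<open>i\<close> of \<open>S *v b\<close>.\<close>
  also have "\<dots> = (\<Sum>i\<in>UNIV. \<Sum>b\<in>B. ((S *v b) $ i)\<^sup>2)"
    by (subst parseval) (simp add: matrix_mult_dot power2_eq_square row_def)
  also have "\<dots> = (\<Sum>b\<in>B. (S *v b) \<bullet> (S *v b))"
    by (subst sum.swap) (simp add: inner_vec_def power2_eq_square)
  also have "\<dots> = (\<Sum>b\<in>B. (ev b)\<^sup>2)"
    using n1 ev by (intro sum.cong) (auto simp: norm_eq_1 power2_eq_square)
  finally show "(\<Sum>t\<in>#eigenvalue_mset S. t\<^sup>2) = trace (S ** S)"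
    by (simp add: mset sum_unfold_sum_mset image_mset.compositionality comp_def)
qed

text \<open>The hypothesis \<open>sym\<close> makes \<open>A\<close> self-adjoint for the inner
  product weighted by \<open>w\<close>. The map \<open>L\<close> carries that product to the
  standard one and \<open>A\<close> to the symmetric matrix \<open>S\<close>.\<close>

lemma eigenvalue_mset_symmetrizable:
  fixes A :: "real ^ 'n ^ 'n" and w :: "'n \<Rightarrow> real"
  assumes w: "\<And>x. w x > 0" and sym: "\<And>x y. w x * A $ x $ y = w y * A $ y $ x"
  shows "size (eigenvalue_mset A) = CARD('n)"
    and "(\<Sum>t\<in>#eigenvalue_mset A. t\<^sup>2) = trace (A ** A)"
proof -
  define S :: "real ^ 'n ^ 'n" where "S = (\<chi> x y. sqrt (w x) * A $ x $ y / sqrt (w y))"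
  define L :: "real ^ 'n \<Rightarrow> real ^ 'n" where "L v = (\<chi> x. sqrt (w x) * v $ x)" for v
  have w0 [simp]: "w x \<noteq> 0" for x using w[of x] by simp
  have sq: "sqrt (w x) * sqrt (w x) = w x" for x using w[of x] by simp
  have "S $ x $ y = S $ y $ x" for x y
  proof -
    \<comment> \<open>This is the symmetry of \<open>S\<close> with the denominators
      cleared.\<close>
    have "(sqrt (w x) * A $ x $ y) * sqrt (w x) = (sqrt (w y) * A $ y $ x) * sqrt (w y)"
      using sym[of x y] sq[of x] sq[of y] by algebra
    then show ?thesis by (simp add: S_def frac_eq_eq)
  qed
  then have symS: "transpose S = S" by (simp add: transpose_def vec_eq_iff)
  have linL: "linear L"
    by (rule linearI) (auto simp: L_def vec_eq_iff algebra_simps)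
  have injL: "inj L" by (auto simp: inj_def L_def vec_eq_iff)
  have surjL: "surj L" using linL injL by (simp add: linear_injective_imp_surjective)
  have comm: "S *v L v = L (A *v v)" for v
    by (simp add: S_def L_def vec_eq_iff matrix_vector_mult_def sum_distrib_left mult.assoc)
  have "eigenspace S t = L ` eigenspace A t" for t
  proof
    show "L ` eigenspace A t \<subseteq> eigenspace S t"
      using linL by (auto simp: eigenspace_def comm linear_scale)
    show "eigenspace S t \<subseteq> L ` eigenspace A t"
    proof
      fix u assume u: "u \<in> eigenspace S t"
      obtain v where v: "u = L v" using surjL by auto
      with u have "L (A *v v) = L (t *\<^sub>R v)"
        using linL by (simp add: eigenspace_def comm linear_scale)
      with injL v show "u \<in> L ` eigenspace A t" by (auto simp: inj_def eigenspace_def)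
    qed
  qed
  then have "dim (eigenspace S t) = dim (eigenspace A t)" for t
    using dim_image_eq[OF linL] injL by (metis inj_on_subset subset_UNIV)
  then have ms: "eigenvalue_mset S = eigenvalue_mset A"
    by (intro multiset_eqI) (simp add: count_eigenvalue_mset)
  \<comment> \<open>The square roots cancel along the closed path from \<open>x\<close> to
    \<open>y\<close> and back.\<close>
  have "S $ x $ y * S $ y $ x = A $ x $ y * A $ y $ x" for x y by (simp add: S_def)
  then have "trace (S ** S) = trace (A ** A)"
    by (simp add: trace_def matrix_matrix_mult_def)
  then show "size (eigenvalue_mset A) = CARD('n)"
    and "(\<Sum>t\<in>#eigenvalue_mset A. t\<^sup>2) = trace (A ** A)"
    using eigenvalue_mset_symmetric[OF symS] ms by simp_all
qed

section \<open>Eigenvalues of reversible kernels\<close>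

lemma sum_pmf_UNIV: "(\<Sum>y\<in>UNIV. pmf p (y::'s::finite)) = 1"
  by (rule sum_pmf_eq_1) auto

lemma set_eigenvalue_mset: "set_mset (eigenvalue_mset A) = spectrum_set A"
proof -
  have "eigenspace A t \<subseteq> {0} \<longleftrightarrow> eigenspace A t = {0}" for t
    using subspace_0[OF subspace_eigenspace[of A t]] by blast
  then have "t \<in> spectrum_set A \<longleftrightarrow> dim (eigenspace A t) \<noteq> 0" for t
    unfolding spectrum_set_def by simp
  then have "t \<in># eigenvalue_mset A \<longleftrightarrow> t \<in> spectrum_set A" for t
    by (metis count_eigenvalue_mset count_eq_zero_iff)
  then show ?thesis by blast
qed

text \<open>Constant functions are eigenvectors, since each row sums to 1.\<close>

lemma one_in_spectrum_transition_matrix: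
  fixes P :: "'s::finite \<Rightarrow> 's pmf"
  shows "1 \<in> spectrum_set (transition_matrix P)"
proof -
  have "(1 :: real ^ 's) \<in> eigenspace (transition_matrix P) 1"
    by (simp add: eigenspace_def transition_matrix_def vec_eq_iff matrix_vector_mult_def
        sum_pmf_UNIV)
  moreover have "(1 :: real ^ 's) \<noteq> 0" by (simp add: vec_eq_iff)
  ultimately show ?thesis unfolding spectrum_set_def by blast
qed

text \<open>Maximum principle: where an eigenvector is largest in absolute value, the kernel
  averages entries that are no larger. The estimate in fact bounds
  \<open>\<bar>t\<bar>\<close>.\<close>

lemma spectrum_transition_matrix_le_1:
  fixes P :: "'s::finite \<Rightarrow> 's pmf"
  assumes "t \<in> spectrum_set (transition_matrix P)"
  shows "t \<le> 1"
proof -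
  obtain v where v: "transition_matrix P *v v = t *\<^sub>R v" "v \<noteq> 0"
    using assms subspace_0[OF subspace_eigenspace[of "transition_matrix P" t]]
    unfolding spectrum_set_def eigenspace_def by blast
  obtain x where max: "\<And>y. \<bar>v $ y\<bar> \<le> \<bar>v $ x\<bar>"
  proof -
    have "Max (range (\<lambda>y. \<bar>v $ y\<bar>)) \<in> range (\<lambda>y. \<bar>v $ y\<bar>)" by (intro Max_in) auto
    then obtain x where "Max (range (\<lambda>y. \<bar>v $ y\<bar>)) = \<bar>v $ x\<bar>" by blast
    moreover have "\<bar>v $ y\<bar> \<le> Max (range (\<lambda>y. \<bar>v $ y\<bar>))" for y by (intro Max_ge) auto
    ultimately show thesis using that by metis
  qed
  have pos: "\<bar>v $ x\<bar> > 0" using v(2) max by (fastforce simp: vec_eq_iff)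
  have "t * v $ x = (\<Sum>y\<in>UNIV. pmf (P x) y * v $ y)"
    using arg_cong[OF v(1), of "\<lambda>u. u $ x"]
    by (simp add: transition_matrix_def matrix_vector_mult_def)
  then have "\<bar>t\<bar> * \<bar>v $ x\<bar> = \<bar>\<Sum>y\<in>UNIV. pmf (P x) y * v $ y\<bar>"
    by (metis abs_mult)
  also have "\<dots> \<le> (\<Sum>y\<in>UNIV. \<bar>pmf (P x) y * v $ y\<bar>)" by (rule sum_abs)
  also have "\<dots> \<le> (\<Sum>y\<in>UNIV. pmf (P x) y * \<bar>v $ x\<bar>)"
    using max by (intro sum_mono) (auto simp: abs_mult intro: mult_left_mono)
  also have "\<dots> = 1 * \<bar>v $ x\<bar>" by (simp add: sum_distrib_right[symmetric] sum_pmf_UNIV)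
  finally show ?thesis using pos by simp
qed

text \<open>The squares of all eigenvalues sum to the trace of the squared matrix; the omitted first
  one is the largest and equals 1, hence the \<open>- 1\<close>.\<close>

lemma sum_eigval_squares:
  fixes P :: "'s::finite \<Rightarrow> 's pmf"
  assumes full: "set_pmf \<pi> = UNIV" and rev: "reversible P \<pi>"
  shows "(\<Sum>i=2..CARD('s). (eigval P i)\<^sup>2) = (\<Sum>x\<in>UNIV. \<Sum>y\<in>UNIV. pmf (P x) y * pmf (P y) x) - 1"
proof -
  let ?A = "transition_matrix P"
  have pos: "pmf \<pi> x > 0" for x using full by (simp add: pmf_positive)
  have sym: "pmf \<pi> x * ?A $ x $ y = pmf \<pi> y * ?A $ y $ x" for x y
    using rev by (simp add: reversible_def transition_matrix_def)
  define l where "l = List.rev (sorted_list_of_multiset (eigenvalue_mset ?A))"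
  have ml: "mset l = eigenvalue_mset ?A" by (simp add: l_def)
  have len: "length l = CARD('s)"
    using eigenvalue_mset_symmetrizable(1)[of "pmf \<pi>" ?A, OF pos sym] ml by (metis size_mset)
  have setl: "set l = spectrum_set ?A" by (metis ml set_eigenvalue_mset set_mset_mset)
  have lne: "l \<noteq> []" using len by auto
  have "hd l = 1"
  proof (rule antisym)
    show "hd l \<le> 1" using lne setl spectrum_transition_matrix_le_1 hd_in_set by blast
    have "sorted_wrt (\<ge>) l" by (simp add: l_def sorted_wrt_rev)
    then have "\<forall>t\<in>set l. t \<le> hd l" using lne by (cases l) auto
    then show "1 \<le> hd l" using setl one_in_spectrum_transition_matrix by blast
  qed
  \<comment> \<open>\<open>eigval P 1\<close> reads list position 0.\<close>
  then have l0: "l ! 0 = 1" using lne by (simp add: hd_conv_nth)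
  have "trace (?A ** ?A) = (\<Sum>t\<in>#mset l. t\<^sup>2)"
    using eigenvalue_mset_symmetrizable(2)[of "pmf \<pi>" ?A, OF pos sym] ml by simp
  also have "\<dots> = sum_list (map (\<lambda>t. t\<^sup>2) l)" by (metis mset_map sum_mset_sum_list)
  also have "\<dots> = (\<Sum>i<CARD('s). (l ! i)\<^sup>2)"
    using len by (simp add: sum_list_sum_nth atLeast0LessThan)
  also have "\<dots> = (\<Sum>i=1..CARD('s). (eigval P i)\<^sup>2)"
    unfolding eigval_def l_def[symmetric]
    by (rule sum.reindex_bij_witness[of _ "\<lambda>i. i - 1" Suc]) auto
  also have "\<dots> = 1 + (\<Sum>i=2..CARD('s). (eigval P i)\<^sup>2)"
  proof -
    have "{1..CARD('s)} = insert 1 {2..CARD('s)}"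
      using zero_less_card_finite[where 'a='s] by (auto simp del: zero_less_card_finite)
    then show ?thesis using l0 by (simp add: eigval_def l_def)
  qed
  finally show ?thesis
    by (simp add: trace_def matrix_matrix_mult_def transition_matrix_def)
qed

section \<open>Divergence bounds\<close>

text \<open>Here \<open>ln u \<le> u - 1\<close> is used at the inverse ratio
  \<open>pmf \<nu> x / pmf \<mu> x\<close>; the resulting lower bounds
  \<open>pmf \<mu> x - pmf \<nu> x\<close> sum to 0.\<close>

lemma kl_div_nonneg:
  assumes full: "set_pmf \<nu> = UNIV"
  shows "0 \<le> kl_div \<mu> \<nu>"
proof -
  have "pmf \<mu> x - pmf \<nu> x \<le> pmf \<mu> x * ln (pmf \<mu> x / pmf \<nu> x)" for x
  proof (cases "pmf \<mu> x = 0")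
    case False
    have p: "pmf \<mu> x > 0" "pmf \<nu> x > 0" using False full by (simp_all add: pmf_pos pmf_positive)
    have "ln (pmf \<nu> x / pmf \<mu> x) \<le> pmf \<nu> x / pmf \<mu> x - 1" using p by (intro ln_le_minus_one) auto
    then have "1 - pmf \<nu> x / pmf \<mu> x \<le> ln (pmf \<mu> x / pmf \<nu> x)" using p by (simp add: ln_div)
    then have "pmf \<mu> x * (1 - pmf \<nu> x / pmf \<mu> x) \<le> pmf \<mu> x * ln (pmf \<mu> x / pmf \<nu> x)"
      using p by (intro mult_left_mono) auto
    then show ?thesis using p by (simp add: right_diff_distrib)
  qed simp
  then have "(\<Sum>x\<in>UNIV. pmf \<mu> x - pmf \<nu> x) \<le> kl_div \<mu> \<nu>"
    unfolding kl_div_def by (intro sum_mono)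
  then show ?thesis by (simp add: sum_subtractf sum_pmf_UNIV)
qed

lemma kl_div_le_chi_square:
  assumes full: "set_pmf \<nu> = UNIV"
  shows "kl_div \<mu> \<nu> \<le> (\<Sum>x\<in>UNIV. (pmf \<mu> x)\<^sup>2 / pmf \<nu> x) - 1"
proof -
  have "pmf \<mu> x * ln (pmf \<mu> x / pmf \<nu> x) \<le> (pmf \<mu> x)\<^sup>2 / pmf \<nu> x - pmf \<mu> x" for x
  proof (cases "pmf \<mu> x = 0")
    case False
    have p: "pmf \<mu> x > 0" "pmf \<nu> x > 0" using False full by (simp_all add: pmf_pos pmf_positive)
    have "pmf \<mu> x * ln (pmf \<mu> x / pmf \<nu> x) \<le> pmf \<mu> x * (pmf \<mu> x / pmf \<nu> x - 1)"
      using p by (intro mult_left_mono ln_le_minus_one) auto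
    then show ?thesis by (simp add: power2_eq_square algebra_simps)
  qed simp
  then have "kl_div \<mu> \<nu> \<le> (\<Sum>x\<in>UNIV. (pmf \<mu> x)\<^sup>2 / pmf \<nu> x - pmf \<mu> x)"
    unfolding kl_div_def by (intro sum_mono)
  then show ?thesis by (simp add: sum_subtractf sum_pmf_UNIV)
qed

lemma one_step_info_eq: "one_step_info P \<pi> = (\<Sum>x\<in>UNIV. pmf \<pi> x * kl_div (P x) \<pi>)"
  by (simp add: one_step_info_def kl_div_def sum_distrib_left mult.assoc)

lemma mean_kl_div_le_sum_eigval_squares:
  fixes P :: "'s::finite \<Rightarrow> 's pmf"
  assumes full: "set_pmf \<pi> = UNIV" and rev: "reversible P \<pi>"
  shows "(\<Sum>x\<in>UNIV. pmf \<pi> x * kl_div (P x) \<pi>) \<le> (\<Sum>i=2..CARD('s). (eigval P i)\<^sup>2)"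
proof -
  have pos: "pmf \<pi> x > 0" for x using full by (simp add: pmf_positive)
  \<comment> \<open>Detailed balance replaces one factor of the square, and the weight at
    \<open>y\<close> cancels; what remains is a summand of the trace.\<close>
  have eq: "pmf \<pi> x * ((pmf (P x) y)\<^sup>2 / pmf \<pi> y) = pmf (P x) y * pmf (P y) x" for x y
  proof -
    have "pmf \<pi> x * pmf (P x) y = pmf \<pi> y * pmf (P y) x" using rev by (simp add: reversible_def)
    then show ?thesis using pos[of y] by (simp add: power2_eq_square field_simps)
  qed
  have "(\<Sum>x\<in>UNIV. pmf \<pi> x * kl_div (P x) \<pi>)
      \<le> (\<Sum>x\<in>UNIV. pmf \<pi> x * ((\<Sum>y\<in>UNIV. (pmf (P x) y)\<^sup>2 / pmf \<pi> y) - 1))"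
    by (intro sum_mono mult_left_mono kl_div_le_chi_square full) auto
  also have "\<dots> = (\<Sum>x\<in>UNIV. \<Sum>y\<in>UNIV. pmf (P x) y * pmf (P y) x) - 1"
    by (simp add: right_diff_distrib sum_subtractf sum_pmf_UNIV sum_distrib_left eq del: times_divide_eq_right)
  finally show ?thesis by (simp add: sum_eigval_squares[OF full rev])
qed

text \<open>Makes the logarithm of the inverse maximal mass strictly positive. A second state of
  positive mass keeps each single mass below 1.\<close>

lemma Max_pmf_less_1:
  fixes \<pi> :: "'s::finite pmf"
  assumes full: "set_pmf \<pi> = UNIV" and n2: "CARD('s) \<ge> 2"
  shows "Max (range (pmf \<pi>)) < 1"
proof -
  have "pmf \<pi> x < 1" for x
  proof -
    have "\<exists>y. y \<noteq> x"
    proof (rule ccontr)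
      assume "\<nexists>y. y \<noteq> x"
      then have "(UNIV :: 's set) = {x}" by auto
      then have "CARD('s) = card {x}" by (simp only:)
      with n2 show False by simp
    qed
    then obtain y where "y \<noteq> x" by blast
    then have "pmf \<pi> x + pmf \<pi> y = (\<Sum>z\<in>{x, y}. pmf \<pi> z)" by simp
    also have "\<dots> \<le> (\<Sum>z\<in>UNIV. pmf \<pi> z)" by (intro sum_mono2) auto
    finally show ?thesis
      using pmf_positive[of y \<pi>] full by (simp add: sum_pmf_UNIV)
  qed
  then show ?thesis by simp
qed

text \<open>The denominator \<open>ln (1 / pmf \<pi> x)\<close> is smallest at the largest mass, and
  the numerators are nonnegative, so using the smallest one throughout only increases the
  mean.\<close>

lemma mean_kl_retention_le:
  fixes P :: "'s::finite \<Rightarrow> 's pmf"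
  assumes full: "set_pmf \<pi> = UNIV" and n2: "CARD('s) \<ge> 2"
  shows "mean_kl_retention P \<pi>
    \<le> (\<Sum>x\<in>UNIV. pmf \<pi> x * kl_div (P x) \<pi>) / ln (1 / Max (range (pmf \<pi>)))"
proof -
  let ?M = "Max (range (pmf \<pi>))"
  have pos: "pmf \<pi> x > 0" for x using full by (simp add: pmf_positive)
  have le: "pmf \<pi> x \<le> ?M" for x by (intro Max_ge) auto
  have M: "0 < ?M" "?M < 1" using less_le_trans[OF pos le] Max_pmf_less_1[OF assms] by blast+
  have "kl_retention P \<pi> x \<le> kl_div (P x) \<pi> / ln (1 / ?M)" for x
    unfolding kl_retention_def
  proof (rule divide_left_mono)
    show le': "ln (1 / ?M) \<le> ln (1 / pmf \<pi> x)"
      using pos[of x] le[of x] M by (simp add: ln_div)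
    have "0 < ln (1 / ?M)" using M by (simp add: ln_div)
    with le' show "0 < ln (1 / pmf \<pi> x) * ln (1 / ?M)" by simp
  qed (rule kl_div_nonneg[OF full])
  then have "mean_kl_retention P \<pi> \<le> (\<Sum>x\<in>UNIV. pmf \<pi> x * (kl_div (P x) \<pi> / ln (1 / ?M)))"
    unfolding mean_kl_retention_def by (intro sum_mono mult_left_mono) auto
  then show ?thesis by (simp add: sum_divide_distrib)
qed

text \<open>By definition \<open>1 - abs_spectral_gap P\<close> is the maximum of
  \<open>\<bar>eigval P i\<bar>\<close> over the summed indices, so each term is at most its
  square.\<close>

lemma sum_eigval_squares_le_gap:
  fixes P :: "'s::finite \<Rightarrow> 's pmf"
  shows "(\<Sum>i=2..CARD('s). (eigval P i)\<^sup>2) \<le> (real CARD('s) - 1) * (1 - abs_spectral_gap P)\<^sup>2"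
proof -
  have "(eigval P i)\<^sup>2 \<le> (1 - abs_spectral_gap P)\<^sup>2" if "i \<in> {2..CARD('s)}" for i
  proof -
    have "\<bar>eigval P i\<bar> \<le> 1 - abs_spectral_gap P"
      unfolding abs_spectral_gap_def using that by (auto intro: Max_ge)
    then show ?thesis by (metis abs_ge_zero power2_abs power_mono)
  qed
  then have "(\<Sum>i=2..CARD('s). (eigval P i)\<^sup>2)
      \<le> real (card {2..CARD('s)}) * (1 - abs_spectral_gap P)\<^sup>2"
    by (rule sum_bounded_above)
  also have "real (card {2..CARD('s)}) = real CARD('s) - 1"
    using zero_less_card_finite[where 'a='s] by (simp add: of_nat_diff del: zero_less_card_finite)
  finally show ?thesis .
qed

theorem theorem5p3:
  fixes P :: "'s::finite \<Rightarrow> 's pmf" and \<pi> :: "'s pmf" and n :: nat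
  assumes "n = CARD('s)" and "n \<ge> 2"
    and "stationary P \<pi>" and "set_pmf \<pi> = UNIV"
    and "reversible P \<pi>"
  shows "one_step_info P \<pi> = (\<Sum>x\<in>UNIV. pmf \<pi> x * kl_div (P x) \<pi>) \<and>
    (\<Sum>x\<in>UNIV. pmf \<pi> x * kl_div (P x) \<pi>) \<le> (\<Sum>i=2..n. (eigval P i)\<^sup>2) \<and>
    mean_kl_retention P \<pi>
      \<le> (\<Sum>i=2..n. (eigval P i)\<^sup>2) / ln (1 / Max (range (pmf \<pi>))) \<and>
    (\<pi> = pmf_of_set UNIV \<longrightarrow>
      mean_kl_retention P \<pi> \<le> (\<Sum>i=2..n. (eigval P i)\<^sup>2) / ln (real n) \<and>
      (\<Sum>i=2..n. (eigval P i)\<^sup>2) / ln (real n)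
        \<le> (real n - 1) * (1 - abs_spectral_gap P)\<^sup>2 / ln (real n))"
proof -
  let ?M = "Max (range (pmf \<pi>))"
  have n2: "CARD('s) \<ge> 2" using assms by simp
  have info: "(\<Sum>x\<in>UNIV. pmf \<pi> x * kl_div (P x) \<pi>) \<le> (\<Sum>i=2..n. (eigval P i)\<^sup>2)"
    using mean_kl_div_le_sum_eigval_squares[OF assms(4,5)] assms(1) by simp
  \<comment> \<open>\<open>undefined\<close> stands for an arbitrary state; its positive mass makes
    \<open>?M\<close> positive.\<close>
  have "pmf \<pi> undefined \<le> ?M" by (intro Max_ge) auto
  then have M: "0 < ?M" "?M < 1"
    using Max_pmf_less_1[OF assms(4) n2] pmf_positive[of undefined \<pi>] assms(4)
    by (blast intro: less_le_trans)+
  then have "0 \<le> ln (1 / ?M)" by (simp add: ln_div pmf_le_1)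
  then have ret: "mean_kl_retention P \<pi> \<le> (\<Sum>i=2..n. (eigval P i)\<^sup>2) / ln (1 / ?M)"
    using mean_kl_retention_le[OF assms(4) n2, of P] divide_right_mono[OF info] by force
  \<comment> \<open>Under the uniform law all masses are \<open>1 / real n\<close>, so the
    denominator in \<open>ret\<close> becomes \<open>ln (real n)\<close>.\<close>
  have unif: "1 / ?M = real n" if "\<pi> = pmf_of_set UNIV"
  proof -
    have "range (pmf \<pi>) = {1 / real n}" using that assms(1) by auto
    then show ?thesis by simp
  qed
  have gap: "(\<Sum>i=2..n. (eigval P i)\<^sup>2) / ln (real n)
      \<le> (real n - 1) * (1 - abs_spectral_gap P)\<^sup>2 / ln (real n)"
    using sum_eigval_squares_le_gap[of P] assms(1,2) by (intro divide_right_mono) auto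
  from info ret unif gap show ?thesis by (auto simp: one_step_info_eq)
qed

end
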